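(* Let $\beta=b_i(x)y^i$ be given by a 1-form on $M$. In each of the following cases, if the given Finsler space satisfies the b-condition, then it is Riemannian: (a) a two-dimensional Finsler space $(M,L)$; (b) a three-dimensional Finsler space $(M,L)$ satisfying $L(x,-y)=L(x,y)$; (c) a quasi-C-reducible space $(M,L)$ with $b^ib^jQ_{ij}\neq0$; (d) a C-reducible space $(M,L)$; (e) the transformed space $(M,\overline L)$ of a Riemannian space $(M,L)$ under a generalized $\beta$-conformal change $\overline L=f(e^{\sigma}L,\beta)$ (the b-condition for $(M,\overline L)$ being $b^i\overline C_{ijk}=0$).
   Context: For an $n$-dimensional smooth Finsler manifold $(M,L)$ (with $L$ smooth on the slit tangent bundle): $\dot\partial_i=\partial/\partial y^i$, $g_{ij}=\frac12\dot\partial_i\dot\partial_jL^2$, $l_i=\dot\partial_iL$, $y_i=g_{ij}y^j$, $h_{ij}=g_{ij}-l_il_j$, $C_{ijk}=\frac12\dot\partial_kg_{ij}$, $C_i=C_{ijk}g^{jk}$, $b^i=g^{ij}b_j$. Standing assumption: $m_i:=b_i-(\beta/L^2)y_i\neq0$ and $m^2:=g^{ij}m_im_j\neq0$ at the points under consideration. $(M,L)$ satisfies the b-condition if $b^iC_{ijk}=0$. $(M,L)$ is Riemannian if $C_{ijk}=0$. For $n\ge3$: $(M,L)$ is quasi-C-reducible if $C_{ijk}=Q_{ij}C_k+Q_{jk}C_i+Q_{ki}C_j$ for a symmetric indicatory tensor $Q_{ij}$ ($Q_{ij}y^i=0$); it is C-reducible if $C_{ijk}=\frac1{n+1}(h_{ij}C_k+h_{ki}C_j+h_{jk}C_i)$.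 A generalized $\beta$-conformal change is $L\mapsto\overline{L}=f(\widetilde L,\beta)$ with $\widetilde L=e^{\sigma(x)}L$, $\sigma$ a smooth function on $M$, and $f$ smooth and positively homogeneous of degree one in $(\widetilde L,\beta)$; it is assumed that $(M,\overline L)$ is a Finsler space, with Cartan tensor $\overline C_{ijk}$; $b^i=g^{ij}b_j$ is formed with the metric of $L$. *)

theory Defs
  imports "HOL-Analysis.Analysis"
begin

section \<open>Smooth maps and smooth manifolds\<close>

text \<open>\<open>Ck_on\<close> and \<open>smooth_on\<close> are meant for, and only used with, open sets \<open>S\<close>.\<close>

primrec Ck_on :: "nat \<Rightarrow> ('a::real_normed_vector \<Rightarrow> 'b::real_normed_vector) \<Rightarrow> 'a set \<Rightarrow> bool" where
  "Ck_on 0 = (\<lambda>f S. continuous_on S f)"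
| "Ck_on (Suc k) = (\<lambda>f S. (\<forall>x\<in>S. f differentiable (at x)) \<and>
      (\<forall>v. Ck_on k (\<lambda>x. frechet_derivative f (at x) v) S))"

definition smooth_on :: "('a::real_normed_vector \<Rightarrow> 'b::real_normed_vector) \<Rightarrow> 'a set \<Rightarrow> bool" where
  "smooth_on f S \<longleftrightarrow> (\<forall>k. Ck_on k f S)"

text \<open>A chart is a pair of its domain and its coordinate map; the dimension of the manifold
  is \<open>CARD('n)\<close>.\<close>

type_synonym ('m, 'n) chart = "'m set \<times> ('m \<Rightarrow> real^'n)"

definition chart_image :: "('m, 'n::finite) chart \<Rightarrow> (real^'n) set" where
  "chart_image c = snd c ` fst c"

definition chart_inv :: "('m, 'n::finite) chart \<Rightarrow> real^'n \<Rightarrow> 'm" where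
  "chart_inv c = inv_into (fst c) (snd c)"

definition transition :: "('m, 'n::finite) chart \<Rightarrow> ('m, 'n) chart \<Rightarrow> real^'n \<Rightarrow> real^'n" where
  "transition c d = snd d \<circ> chart_inv c"

definition smooth_manifold :: "'m topology \<Rightarrow> ('m, 'n::finite) chart set \<Rightarrow> bool" where
  "smooth_manifold M A \<longleftrightarrow>
     Hausdorff_space M \<and> second_countable M \<and>
     (\<Union>c\<in>A. fst c) = topspace M \<and>
     (\<forall>c\<in>A. openin M (fst c) \<and> open (chart_image c) \<and>
        homeomorphic_map (subtopology M (fst c)) (top_of_set (chart_image c)) (snd c)) \<and>
     (\<forall>c\<in>A. \<forall>d\<in>A. smooth_on (transition c d) (snd c ` (fst c \<inter> fst d)))"

text \<open>A function on the tangent bundle is given by its coordinate expressions \<open>F c x y\<close>,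
  with \<open>x\<close> the coordinates of the base point in the chart \<open>c\<close> and \<open>y\<close> the induced fibre
  coordinates. Fibre coordinates transform by the differential of the change of charts;
  \<open>push c d p\<close> is this differential at the point \<open>p\<close>.\<close>

definition push :: "('m, 'n::finite) chart \<Rightarrow> ('m, 'n) chart \<Rightarrow> 'm \<Rightarrow> real^'n \<Rightarrow> real^'n" where
  "push c d p = frechet_derivative (transition c d) (at (snd c p))"

definition tangent_function ::
  "('m, 'n::finite) chart set \<Rightarrow> (('m, 'n) chart \<Rightarrow> real^'n \<Rightarrow> real^'n \<Rightarrow> real) \<Rightarrow> bool" where
  "tangent_function A F \<longleftrightarrow>
     (\<forall>c\<in>A. \<forall>d\<in>A. \<forall>p \<in> fst c \<inter> fst d. \<forall>y.
        F c (snd c p) y = F d (snd d p) (push c d p y))"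

text \<open>The components \<open>b\<^sub>i(x)\<close> of a smooth 1-form; \<open>\<beta> = b\<^sub>i(x) y\<^sup>i\<close> is a function on the
  tangent bundle, which is the covector transformation law.\<close>

definition one_form ::
  "('m, 'n::finite) chart set \<Rightarrow> (('m, 'n) chart \<Rightarrow> real^'n \<Rightarrow> real^'n) \<Rightarrow> bool" where
  "one_form A b \<longleftrightarrow>
     (\<forall>c\<in>A. smooth_on (b c) (chart_image c)) \<and> tangent_function A (\<lambda>c x y. b c x \<bullet> y)"

definition smooth_function :: "('m, 'n::finite) chart set \<Rightarrow> ('m \<Rightarrow> real) \<Rightarrow> bool" where
  "smooth_function A s \<longleftrightarrow> (\<forall>c\<in>A. smooth_on (s \<circ> chart_inv c) (chart_image c))"

definition slit :: "('m, 'n::finite) chart set \<Rightarrow> (('m, 'n) chart \<times> (real^'n) \<times> (real^'n)) set" where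
  "slit A = {(c, x, y). c \<in> A \<and> x \<in> chart_image c \<and> y \<noteq> 0}"


section \<open>Tensors of a Finsler function on one fibre\<close>

text \<open>In this section \<open>F\<close> stands for \<open>y \<mapsto> L(x,y)\<close> with the base point \<open>x\<close> fixed, and \<open>b\<close>
  for the components \<open>b\<^sub>i(x)\<close>.\<close>

definition dotd :: "'n::finite \<Rightarrow> (real^'n \<Rightarrow> real) \<Rightarrow> real^'n \<Rightarrow> real" where
  "dotd i F y = deriv (\<lambda>t. F (y + t *\<^sub>R axis i 1)) 0"

definition metric :: "(real^'n \<Rightarrow> real) \<Rightarrow> real^'n \<Rightarrow> real^'n^'n::finite" where
  "metric F y = (\<chi> i j. 1/2 * dotd i (dotd j (\<lambda>z. (F z)\<^sup>2)) y)"

definition metric_inv :: "(real^'n \<Rightarrow> real) \<Rightarrow> real^'n \<Rightarrow> real^'n^'n::finite" where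
  "metric_inv F y = matrix_inv (metric F y)"

definition y_low :: "(real^'n \<Rightarrow> real) \<Rightarrow> real^'n \<Rightarrow> 'n::finite \<Rightarrow> real" where
  "y_low F y i = (\<Sum>j\<in>UNIV. metric F y $ i $ j * y $ j)"

definition angular :: "(real^'n \<Rightarrow> real) \<Rightarrow> real^'n \<Rightarrow> 'n::finite \<Rightarrow> 'n \<Rightarrow> real" where
  "angular F y i j = metric F y $ i $ j - dotd i F y * dotd j F y"

definition cartan :: "(real^'n \<Rightarrow> real) \<Rightarrow> real^'n \<Rightarrow> 'n::finite \<Rightarrow> 'n \<Rightarrow> 'n \<Rightarrow> real" where
  "cartan F y i j k = 1/2 * dotd k (\<lambda>z. metric F z $ i $ j) y"

definition cartan_tr :: "(real^'n \<Rightarrow> real) \<Rightarrow> real^'n \<Rightarrow> 'n::finite \<Rightarrow> real" where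
  "cartan_tr F y i = (\<Sum>j\<in>UNIV. \<Sum>k\<in>UNIV. cartan F y i j k * metric_inv F y $ j $ k)"

definition b_up :: "(real^'n \<Rightarrow> real) \<Rightarrow> real^'n \<Rightarrow> real^'n \<Rightarrow> 'n::finite \<Rightarrow> real" where
  "b_up F b y i = (\<Sum>j\<in>UNIV. metric_inv F y $ i $ j * b $ j)"

definition m_low :: "(real^'n \<Rightarrow> real) \<Rightarrow> real^'n \<Rightarrow> real^'n \<Rightarrow> 'n::finite \<Rightarrow> real" where
  "m_low F b y i = b $ i - (b \<bullet> y) / (F y)\<^sup>2 * y_low F y i"

definition m_sq :: "(real^'n \<Rightarrow> real) \<Rightarrow> real^'n \<Rightarrow> real^'n::finite \<Rightarrow> real" where
  "m_sq F b y = (\<Sum>i\<in>UNIV. \<Sum>j\<in>UNIV. metric_inv F y $ i $ j * m_low F b y i * m_low F b y j)"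


section \<open>Finsler manifolds\<close>

text \<open>Only nondegeneracy of the fundamental tensor is demanded.\<close>

definition finsler ::
  "('m, 'n::finite) chart set \<Rightarrow> (('m, 'n) chart \<Rightarrow> real^'n \<Rightarrow> real^'n \<Rightarrow> real) \<Rightarrow> bool" where
  "finsler A L \<longleftrightarrow>
     tangent_function A L \<and>
     (\<forall>c\<in>A. smooth_on (\<lambda>(x, y). L c x y) (chart_image c \<times> (- {0}))) \<and>
     (\<forall>(c, x, y) \<in> slit A. L c x y > 0 \<and> invertible (metric (L c x) y)) \<and>
     (\<forall>c\<in>A. \<forall>x\<in>chart_image c. \<forall>y. \<forall>t>0. L c x (t *\<^sub>R y) = t * L c x y)"

definition riemannian ::
  "('m, 'n::finite) chart set \<Rightarrow> (('m, 'n) chart \<Rightarrow> real^'n \<Rightarrow> real^'n \<Rightarrow> real) \<Rightarrow> bool" where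
  "riemannian A L \<longleftrightarrow> (\<forall>(c, x, y) \<in> slit A. \<forall>i j k. cartan (L c x) y i j k = 0)"

text \<open>The points under consideration are those with \<open>m\<^sub>i \<noteq> 0\<close> and \<open>m\<^sup>2 \<noteq> 0\<close>. No fibre
  consists of such points only, since \<open>m\<^sub>i\<close> vanishes wherever \<open>y\<^sub>i\<close> is proportional to \<open>b\<^sub>i\<close>;
  the standing assumption is that every fibre of the slit tangent bundle contains one.\<close>

definition considered ::
  "('m, 'n::finite) chart set \<Rightarrow> (('m, 'n) chart \<Rightarrow> real^'n \<Rightarrow> real^'n \<Rightarrow> real) \<Rightarrow>
   (('m, 'n) chart \<Rightarrow> real^'n \<Rightarrow> real^'n) \<Rightarrow> (('m, 'n) chart \<times> (real^'n) \<times> (real^'n)) set" where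
  "considered A L b = {(c, x, y) \<in> slit A.
     (\<exists>i. m_low (L c x) (b c x) y i \<noteq> 0) \<and> m_sq (L c x) (b c x) y \<noteq> 0}"

definition standing_assumption ::
  "('m, 'n::finite) chart set \<Rightarrow> (('m, 'n) chart \<Rightarrow> real^'n \<Rightarrow> real^'n \<Rightarrow> real) \<Rightarrow>
   (('m, 'n) chart \<Rightarrow> real^'n \<Rightarrow> real^'n) \<Rightarrow> bool" where
  "standing_assumption A L b \<longleftrightarrow>
     (\<forall>c\<in>A. \<forall>x\<in>chart_image c. \<exists>y. (c, x, y) \<in> considered A L b)"

text \<open>The b-condition of \<open>(M, L')\<close>, with \<open>b\<^sub>i\<close> raised by the metric of \<open>L\<close>; for a single space
  \<open>L' = L\<close>.\<close>

definition b_condition_wrt ::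
  "('m, 'n::finite) chart set \<Rightarrow> (('m, 'n) chart \<Rightarrow> real^'n \<Rightarrow> real^'n \<Rightarrow> real) \<Rightarrow>
   (('m, 'n) chart \<Rightarrow> real^'n \<Rightarrow> real^'n) \<Rightarrow>
   (('m, 'n) chart \<Rightarrow> real^'n \<Rightarrow> real^'n \<Rightarrow> real) \<Rightarrow> bool" where
  "b_condition_wrt A L b L' \<longleftrightarrow> (\<forall>(c, x, y) \<in> slit A. \<forall>j k.
     (\<Sum>i\<in>UNIV. b_up (L c x) (b c x) y i * cartan (L' c x) y i j k) = 0)"

definition b_condition ::
  "('m, 'n::finite) chart set \<Rightarrow> (('m, 'n) chart \<Rightarrow> real^'n \<Rightarrow> real^'n \<Rightarrow> real) \<Rightarrow>
   (('m, 'n) chart \<Rightarrow> real^'n \<Rightarrow> real^'n) \<Rightarrow> bool" where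
  "b_condition A L b \<longleftrightarrow> b_condition_wrt A L b L"

definition reversible ::
  "('m, 'n::finite) chart set \<Rightarrow> (('m, 'n) chart \<Rightarrow> real^'n \<Rightarrow> real^'n \<Rightarrow> real) \<Rightarrow> bool" where
  "reversible A L \<longleftrightarrow> (\<forall>(c, x, y) \<in> slit A. L c x (- y) = L c x y)"

text \<open>\<open>Q c x y $ i $ j\<close> are the components \<open>Q\<^sub>i\<^sub>j(x,y)\<close>; the second conjunct is the
  transformation law of a covariant tensor of rank two.\<close>

definition quasi_C_reducible ::
  "('m, 'n::finite) chart set \<Rightarrow> (('m, 'n) chart \<Rightarrow> real^'n \<Rightarrow> real^'n \<Rightarrow> real) \<Rightarrow>
   (('m, 'n) chart \<Rightarrow> real^'n \<Rightarrow> real^'n \<Rightarrow> real^'n^'n) \<Rightarrow> bool" where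
  "quasi_C_reducible A L Q \<longleftrightarrow>
     CARD('n) \<ge> 3 \<and>
     (\<forall>c\<in>A. \<forall>d\<in>A. \<forall>p \<in> fst c \<inter> fst d. \<forall>y u v. y \<noteq> 0 \<longrightarrow>
        u \<bullet> (Q c (snd c p) y *v v) =
        push c d p u \<bullet> (Q d (snd d p) (push c d p y) *v push c d p v)) \<and>
     (\<forall>(c, x, y) \<in> slit A.
        (\<forall>i j. Q c x y $ i $ j = Q c x y $ j $ i) \<and>
        (\<forall>j. (\<Sum>i\<in>UNIV. Q c x y $ i $ j * y $ i) = 0) \<and>
        (\<forall>i j k. cartan (L c x) y i j k =
           Q c x y $ i $ j * cartan_tr (L c x) y k +
           Q c x y $ j $ k * cartan_tr (L c x) y i +
           Q c x y $ k $ i * cartan_tr (L c x) y j))"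

definition C_reducible ::
  "('m, 'n::finite) chart set \<Rightarrow> (('m, 'n) chart \<Rightarrow> real^'n \<Rightarrow> real^'n \<Rightarrow> real) \<Rightarrow> bool" where
  "C_reducible A L \<longleftrightarrow>
     CARD('n) \<ge> 3 \<and>
     (\<forall>(c, x, y) \<in> slit A. \<forall>i j k. cartan (L c x) y i j k =
        1 / (real CARD('n) + 1) *
          (angular (L c x) y i j * cartan_tr (L c x) y k +
           angular (L c x) y k i * cartan_tr (L c x) y j +
           angular (L c x) y j k * cartan_tr (L c x) y i))"

text \<open>\<open>f\<close> only has to be defined, smooth and homogeneous on an open cone \<open>D\<close> containing all
  values of \<open>(e\<^sup>\<sigma> L, \<beta>)\<close>. As in \<open>finsler\<close>, homogeneity is meant for positive factors.\<close>

definition gen_beta_conformal_change ::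
  "('m, 'n::finite) chart set \<Rightarrow> (('m, 'n) chart \<Rightarrow> real^'n \<Rightarrow> real^'n \<Rightarrow> real) \<Rightarrow>
   (('m, 'n) chart \<Rightarrow> real^'n \<Rightarrow> real^'n) \<Rightarrow>
   (('m, 'n) chart \<Rightarrow> real^'n \<Rightarrow> real^'n \<Rightarrow> real) \<Rightarrow> bool" where
  "gen_beta_conformal_change A L b L' \<longleftrightarrow>
     (\<exists>(s :: 'm \<Rightarrow> real) (f :: real \<Rightarrow> real \<Rightarrow> real) (D :: (real \<times> real) set).
        smooth_function A s \<and>
        open D \<and> smooth_on (\<lambda>(u, v). f u v) D \<and>
        (\<forall>(u, v) \<in> D. \<forall>t>0. (t * u, t * v) \<in> D \<and> f (t * u) (t * v) = t * f u v) \<and>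
        (\<forall>(c, x, y) \<in> slit A.
           (exp (s (chart_inv c x)) * L c x y, b c x \<bullet> y) \<in> D \<and>
           L' c x y = f (exp (s (chart_inv c x)) * L c x y) (b c x \<bullet> y)))"

end

theory Submission
  imports Defs
begin

text \<open>All five cases rest on one argument in a single fibre of the slit tangent bundle.

  Differentiating \<open>g\<^sub>i\<^sub>j b\<^sup>j = b\<^sub>i\<close> with respect to \<open>y\<^sup>k\<close> gives
  \<open>2 C\<^sub>i\<^sub>j\<^sub>k b\<^sup>j + g\<^sub>i\<^sub>j \<partial>b\<^sup>j/\<partial>y\<^sup>k = 0\<close>. If \<open>L\<close> satisfies the b-condition, the first term vanishes, and
  since \<open>g\<close> is nondegenerate the vector \<open>B = (b\<^sup>i)\<close> has zero derivative, so it
  does not depend on \<open>y\<close> in dimension at least two, where the punctured fibre is connected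
  (\<open>b_up_constant\<close>); dimension one is immediate. The standing assumption excludes \<open>b = 0\<close>, so
  \<open>B \<noteq> 0\<close>.

  Now let \<open>F\<close> be a homogeneous function on the fibre, smooth off the origin, whose Cartan tensor
  is annihilated everywhere by a constant vector \<open>B \<noteq> 0\<close>. As \<open>C\<close> is totally symmetric, the
  metric \<open>g\<close> of \<open>F\<close> is constant along straight lines in the direction \<open>B\<close> as long as they avoid
  the origin, and it is homogeneous of degree zero. Hence
  \<open>g(y) = g(y + tB) = g(y/t + B)\<close> for all \<open>t > 0\<close> if \<open>y\<close> does not lie on the ray opposite to \<open>B\<close>.
  In the limit of large \<open>t\<close> this gives \<open>g(y) = g(B)\<close>, by continuity of \<open>g\<close> at \<open>B\<close>. So \<open>g\<close> is
  constant off that ray, and \<open>C = 0\<close> there; exchanging \<open>B\<close> and \<open>-B\<close> covers the ray itself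
  (\<open>cartan_zero_if_annihilated\<close>).

  The cases (a) to (d) are the instance in which \<open>F\<close> is \<open>L\<close> on the fibre. In case (e) the
  Riemannian \<open>L\<close> has \<open>C = 0\<close>, hence satisfies the b-condition and has a constant \<open>B\<close>, and \<open>F\<close> is
  \<open>L'\<close> on the fibre (\<open>riemannian_if_b_conditions\<close>).\<close>

section \<open>Calculus on open sets\<close>

lemma Ck_on_cong:
  assumes "open S" "Ck_on k f S" "\<And>x. x \<in> S \<Longrightarrow> f x = g x"
  shows "Ck_on k g S"
  using assms
proof (induction k arbitrary: f g)
  case 0
  then show ?case by (simp cong: continuous_on_cong)
next
  case (Suc k)
  have *: "(g has_derivative frechet_derivative f (at x)) (at x)" if "x \<in> S" for x
    using Suc.prems that
    by (auto intro!: has_derivative_transform_within_open[of f _ x UNIV S g]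
        simp flip: frechet_derivative_works)
  then have "frechet_derivative f (at x) = frechet_derivative g (at x)" if "x \<in> S" for x
    using that frechet_derivative_at by blast
  then show ?case
    using * Suc.prems Suc.IH[of "\<lambda>x. frechet_derivative f (at x) v" "\<lambda>x. frechet_derivative g (at x) v" for v]
    by (auto simp: differentiable_def)
qed

lemma Ck_on_SucD: "Ck_on (Suc k) f S \<Longrightarrow> Ck_on k f S"
proof (induction k arbitrary: f)
  case 0
  then show ?case
    by (auto intro!: continuous_at_imp_continuous_on differentiable_imp_continuous_within)
next
  case (Suc k)
  then show ?case by (metis Ck_on.simps(2))
qed

lemma Ck_on_add:
  assumes "open S" "Ck_on k f S" "Ck_on k g S"
  shows "Ck_on k (\<lambda>x. f x + g x) S"
  using assms
proof (induction k arbitrary: f g)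
  case 0
  then show ?case by (auto intro: continuous_intros)
next
  case (Suc k)
  have D: "((\<lambda>x. f x + g x) has_derivative
      (\<lambda>v. frechet_derivative f (at x) v + frechet_derivative g (at x) v)) (at x)" if "x \<in> S" for x
    using Suc.prems that by (auto intro!: derivative_intros simp flip: frechet_derivative_works)
  have "Ck_on k (\<lambda>x. frechet_derivative (\<lambda>x. f x + g x) (at x) v) S" for v
  proof (rule Ck_on_cong[OF \<open>open S\<close>])
    show "Ck_on k (\<lambda>x. frechet_derivative f (at x) v + frechet_derivative g (at x) v) S"
      using Suc by auto
  qed (simp flip: frechet_derivative_at[OF D])
  with Suc.prems show ?case by auto
qed

lemma Ck_on_mult:
  fixes f g :: "'a::real_normed_vector \<Rightarrow> real"
  assumes "open S" "Ck_on k f S" "Ck_on k g S"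
  shows "Ck_on k (\<lambda>x. f x * g x) S"
  using assms
proof (induction k arbitrary: f g)
  case 0
  then show ?case by (auto intro: continuous_intros)
next
  case (Suc k)
  have D: "((\<lambda>x. f x * g x) has_derivative
      (\<lambda>v. f x * frechet_derivative g (at x) v + frechet_derivative f (at x) v * g x)) (at x)"
    if "x \<in> S" for x
    using Suc.prems that by (auto intro!: has_derivative_mult simp flip: frechet_derivative_works)
  have "Ck_on k (\<lambda>x. frechet_derivative (\<lambda>x. f x * g x) (at x) v) S" for v
  proof (rule Ck_on_cong[OF \<open>open S\<close>])
    show "Ck_on k (\<lambda>x. f x * frechet_derivative g (at x) v + frechet_derivative f (at x) v * g x) S"
      using Suc.prems Ck_on_SucD[of k f S] Ck_on_SucD[of k g S]
      by (intro Ck_on_add Suc.IH) auto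
  qed (simp flip: frechet_derivative_at[OF D])
  with Suc.prems show ?case by auto
qed

text \<open>The derivative of a slice at \<open>y\<close> in the direction \<open>v\<close> is the derivative of \<open>f\<close> at
  \<open>(x, y)\<close> in the direction \<open>(0, v)\<close>, so the induction stays within slices.\<close>

lemma Ck_on_slice:
  assumes "open V" "x \<in> U" "Ck_on k f (U \<times> V)"
  shows "Ck_on k (\<lambda>y. f (x, y)) V"
  using assms
proof (induction k arbitrary: f)
  case 0
  then show ?case
    by (auto intro!: continuous_on_compose2[of "U \<times> V" f] continuous_intros)
next
  case (Suc k)
  have D: "((\<lambda>y. f (x, y)) has_derivative (\<lambda>v. frechet_derivative f (at (x, y)) (0, v))) (at y)"
    if "y \<in> V" for y
  proof (rule has_derivative_compose[of "\<lambda>y. (x, y)" "\<lambda>v. (0, v)"])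
    show "(f has_derivative frechet_derivative f (at (x, y))) (at (x, y))"
      using Suc.prems that by (auto simp flip: frechet_derivative_works)
  qed (auto intro!: derivative_eq_intros)
  have "Ck_on k (\<lambda>y. frechet_derivative (\<lambda>y. f (x, y)) (at y) v) V" for v
  proof (rule Ck_on_cong[OF \<open>open V\<close>])
    show "Ck_on k (\<lambda>y. frechet_derivative f (at (x, y)) (0, v)) V"
      using Suc.prems by (intro Suc.IH) auto
  qed (simp flip: frechet_derivative_at[OF D])
  with D show ?case by (auto simp: differentiable_def)
qed

text \<open>The second difference of \<open>f\<close> over a parallelogram with sides \<open>su\<close> and \<open>sv\<close> is \<open>s\<^sup>2\<close> times a
  mixed derivative at an interior point: the mean value theorem is applied to the difference
  in the direction \<open>v\<close> as a function along \<open>u\<close>, and then to \<open>\<partial>\<^sub>u f\<close> along \<open>v\<close>.\<close>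

lemma second_difference_mean_value:
  fixes f :: "'a::real_normed_vector \<Rightarrow> real"
  assumes s: "0 < s"
    and sub: "\<And>t r. \<lbrakk>0 \<le> t; t \<le> s; 0 \<le> r; r \<le> s\<rbrakk> \<Longrightarrow> x + t *\<^sub>R u + r *\<^sub>R v \<in> S"
    and f: "\<And>z. z \<in> S \<Longrightarrow> f differentiable (at z)"
    and fu: "\<And>z. z \<in> S \<Longrightarrow> (\<lambda>z. frechet_derivative f (at z) u) differentiable (at z)"
  obtains t r where "0 < t" "t < s" "0 < r" "r < s"
    "f (x + s *\<^sub>R u + s *\<^sub>R v) - f (x + s *\<^sub>R u) - f (x + s *\<^sub>R v) + f x =
       s * s * frechet_derivative (\<lambda>z. frechet_derivative f (at z) u) (at (x + t *\<^sub>R u + r *\<^sub>R v)) v"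
proof -
  let ?fu = "\<lambda>z. frechet_derivative f (at z) u"
  have D: "((\<lambda>t. g (p + t *\<^sub>R w)) has_derivative (\<lambda>h. h * frechet_derivative g (at (p + t *\<^sub>R w)) w))
      (at t within T)" if "g differentiable (at (p + t *\<^sub>R w))"
    for g :: "'a \<Rightarrow> real" and p w t T
  proof -
    have g': "(g has_derivative frechet_derivative g (at (p + t *\<^sub>R w))) (at (p + t *\<^sub>R w))"
      using that by (simp flip: frechet_derivative_works)
    have "((\<lambda>t. g (p + t *\<^sub>R w)) has_derivative
        (\<lambda>h. frechet_derivative g (at (p + t *\<^sub>R w)) (h *\<^sub>R w))) (at t within T)"
      by (rule has_derivative_compose[of "\<lambda>t. p + t *\<^sub>R w", OF _ g'])
        (auto intro!: derivative_eq_intros)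
    then show ?thesis
      using has_derivative_bounded_linear[OF g']
      by (simp add: linear_simps bounded_linear.linear linear_scale)
  qed
  have "\<exists>t\<in>{0<..<s}. (f (x + s *\<^sub>R v + s *\<^sub>R u) - f (x + s *\<^sub>R u)) - (f (x + s *\<^sub>R v + 0 *\<^sub>R u) - f (x + 0 *\<^sub>R u))
      = (s - 0) * ?fu (x + s *\<^sub>R v + t *\<^sub>R u) - (s - 0) * ?fu (x + t *\<^sub>R u)"
    using s sub[of _ s] sub[of _ 0]
    by (intro mvt_simple has_derivative_diff D f) (auto simp: algebra_simps)
  then obtain t where t: "0 < t" "t < s"
    "f (x + s *\<^sub>R u + s *\<^sub>R v) - f (x + s *\<^sub>R u) - f (x + s *\<^sub>R v) + f x
      = s * (?fu (x + t *\<^sub>R u + s *\<^sub>R v) - ?fu (x + t *\<^sub>R u + 0 *\<^sub>R v))"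
    by (auto simp: algebra_simps)
  have "\<exists>r\<in>{0<..<s}. ?fu (x + t *\<^sub>R u + s *\<^sub>R v) - ?fu (x + t *\<^sub>R u + 0 *\<^sub>R v) =
      (s - 0) * frechet_derivative ?fu (at (x + t *\<^sub>R u + r *\<^sub>R v)) v"
    using s sub[of t] t by (intro mvt_simple D fu) auto
  with t that show ?thesis by (auto simp: algebra_simps)
qed

text \<open>The second difference is symmetric in \<open>u\<close> and \<open>v\<close>. Hence on arbitrarily small
  parallelograms the two mixed derivatives take a common value, at points that may differ;
  continuity carries the equality to \<open>x\<close>.\<close>

lemma frechet_derivative_commute:
  fixes f :: "'a::real_normed_vector \<Rightarrow> real"
  assumes S: "open S" "x \<in> S" and f: "Ck_on 2 f S"
  shows "frechet_derivative (\<lambda>z. frechet_derivative f (at z) u) (at x) v =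
    frechet_derivative (\<lambda>z. frechet_derivative f (at z) v) (at x) u"
    (is "?p u v x = ?p v u x")
proof (rule ccontr)
  assume "?p u v x \<noteq> ?p v u x"
  define e where "e = dist (?p u v x) (?p v u x) / 2"
  have e: "0 < e" using \<open>?p u v x \<noteq> ?p v u x\<close> by (simp add: e_def)
  have C: "\<And>z. z \<in> S \<Longrightarrow> f differentiable (at z)"
    "\<And>z w. z \<in> S \<Longrightarrow> (\<lambda>z. frechet_derivative f (at z) w) differentiable (at z)"
    "\<And>w w'. continuous_on S (?p w w')"
    using f by (auto simp: numeral_2_eq_2)
  have "eventually (\<lambda>z. dist (?p w w' z) (?p w w' x) < e) (nhds x)" for w w'
  proof -
    have "isCont (?p w w') x"
      using C(3)[of w w'] S by (simp add: continuous_on_eq_continuous_at)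
    then have "(?p w w' \<longlongrightarrow> ?p w w' x) (nhds x)"
      by (simp only: isCont_def tendsto_at_iff_tendsto_nhds[of "?p w w'"])
    then show ?thesis using e by (rule tendstoD)
  qed
  then have "eventually (\<lambda>z. dist (?p u v z) (?p u v x) < e \<and> dist (?p v u z) (?p v u x) < e \<and> z \<in> S) (nhds x)"
    using S by (intro eventually_conj eventually_nhds_in_open) auto
  then obtain d where d: "0 < d" and
    near: "\<And>z. dist z x < d \<Longrightarrow> dist (?p u v z) (?p u v x) < e \<and> dist (?p v u z) (?p v u x) < e \<and> z \<in> S"
    unfolding eventually_nhds_metric by blast
  \<comment> \<open>The size \<open>s\<close> keeps the parallelogram with sides \<open>su\<close> and \<open>sv\<close> within distance \<open>d\<close> of
    \<open>x\<close>; the summand \<open>1\<close> avoids a division by zero when \<open>u = v = 0\<close>.\<close>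
  define N where "N = norm u + norm v + 1"
  have N: "0 < N" by (simp add: N_def add_nonneg_pos)
  define s where "s = d / N / 2"
  have s: "0 < s" using d N by (simp add: s_def)
  have close: "dist (x + t *\<^sub>R u + r *\<^sub>R v) x < d" if "0 \<le> t" "t \<le> s" "0 \<le> r" "r \<le> s" for t r
  proof -
    have "dist (x + t *\<^sub>R u + r *\<^sub>R v) x \<le> norm (t *\<^sub>R u) + norm (r *\<^sub>R v)"
      by (simp add: dist_norm add.assoc norm_triangle_ineq del: norm_scaleR)
    also have "\<dots> \<le> s * norm u + s * norm v"
      using that by (intro add_mono) (auto intro: mult_right_mono)
    also have "\<dots> < d"
    proof -
      have "s * (norm u + norm v) \<le> s * N" using s by (simp add: N_def)
      also have "\<dots> = d / 2" using N by (simp add: s_def)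
      finally show ?thesis using d by (simp add: algebra_simps)
    qed
    finally show ?thesis .
  qed
  obtain t r where 1: "0 < t" "t < s" "0 < r" "r < s"
    "f (x + s *\<^sub>R u + s *\<^sub>R v) - f (x + s *\<^sub>R u) - f (x + s *\<^sub>R v) + f x = s * s * ?p u v (x + t *\<^sub>R u + r *\<^sub>R v)"
    by (rule second_difference_mean_value[where S = S, OF s _ C(1) C(2), of x u v])
      (use close near in blast)+
  have close': "dist (x + t *\<^sub>R v + r *\<^sub>R u) x < d" if "0 \<le> t" "t \<le> s" "0 \<le> r" "r \<le> s" for t r
    using close[of r t] that by (simp add: ac_simps)
  obtain t' r' where 2: "0 < t'" "t' < s" "0 < r'" "r' < s"
    "f (x + s *\<^sub>R v + s *\<^sub>R u) - f (x + s *\<^sub>R v) - f (x + s *\<^sub>R u) + f x = s * s * ?p v u (x + t' *\<^sub>R v + r' *\<^sub>R u)"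
    by (rule second_difference_mean_value[where S = S, OF s _ C(1) C(2), of x v u])
      (use close' near in blast)+
  have "s * s * ?p u v (x + t *\<^sub>R u + r *\<^sub>R v) = s * s * ?p v u (x + t' *\<^sub>R v + r' *\<^sub>R u)"
  proof -
    have "f (x + s *\<^sub>R u + s *\<^sub>R v) = f (x + s *\<^sub>R v + s *\<^sub>R u)" by (simp add: ac_simps)
    with 1(5) 2(5) show ?thesis by linarith
  qed
  then have "?p u v (x + t *\<^sub>R u + r *\<^sub>R v) = ?p v u (x + t' *\<^sub>R v + r' *\<^sub>R u)"
    using s by simp
  moreover have "dist (?p u v (x + t *\<^sub>R u + r *\<^sub>R v)) (?p u v x) < e"
    "dist (?p v u (x + t' *\<^sub>R v + r' *\<^sub>R u)) (?p v u x) < e"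
    using 1 2 near close close' by auto
  ultimately show False
    using dist_triangle3[of "?p u v x" "?p v u x" "?p u v (x + t *\<^sub>R u + r *\<^sub>R v)"]
    by (simp add: e_def)
qed

section \<open>The fundamental tensor on one fibre\<close>

lemma open_punctured: "open (- {0::'a::{t1_space,zero}})"
  by (intro open_Compl closed_singleton)

lemma dotd_eq_frechet:
  assumes "F differentiable (at y)"
  shows "dotd i F y = frechet_derivative F (at y) (axis i 1)"
proof -
  have F: "(F has_derivative frechet_derivative F (at y)) (at (y + 0 *\<^sub>R axis i 1))"
    using assms by (simp flip: frechet_derivative_works)
  have "((\<lambda>t. F (y + t *\<^sub>R axis i 1)) has_derivative (\<lambda>h. frechet_derivative F (at y) (h *\<^sub>R axis i 1))) (at 0)"
    by (rule has_derivative_compose[of "\<lambda>t. y + t *\<^sub>R axis i 1", OF _ F])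
      (auto intro!: derivative_eq_intros)
  then show ?thesis
    unfolding dotd_def using has_derivative_bounded_linear[OF F]
    by (intro DERIV_imp_deriv)
      (simp add: has_field_derivative_def bounded_linear.linear linear_scale mult_commute_abs)
qed

lemma Ck_on_dotd:
  assumes "open S" "Ck_on (Suc k) F S"
  shows "Ck_on k (dotd i F) S"
  by (rule Ck_on_cong[OF \<open>open S\<close>, of _ "\<lambda>y. frechet_derivative F (at y) (axis i 1)"])
    (use assms in \<open>auto simp: dotd_eq_frechet\<close>)

lemma dotd_cong:
  assumes "open S" "y \<in> S" "\<And>z. z \<in> S \<Longrightarrow> F z = G z"
  shows "dotd i F y = dotd i G y"
proof -
  have "((\<lambda>t. y + t *\<^sub>R axis i 1) \<longlongrightarrow> y + 0 *\<^sub>R axis i 1) (nhds (0::real))"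
    by (intro tendsto_intros filterlim_ident)
  then have "eventually (\<lambda>t. y + t *\<^sub>R axis i 1 \<in> S) (nhds 0)"
    using assms(1,2) by (intro topological_tendstoD[of _ y]) auto
  then show ?thesis
    unfolding dotd_def by (intro deriv_cong_ev) (auto elim!: eventually_mono simp: assms(3))
qed

lemma dotd_commute:
  assumes S: "open S" "y \<in> S" and F: "Ck_on 2 F S"
  shows "dotd i (dotd j F) y = dotd j (dotd i F) y"
proof -
  have F': "\<And>z. z \<in> S \<Longrightarrow> F differentiable (at z)"
    "\<And>z v. z \<in> S \<Longrightarrow> (\<lambda>z. frechet_derivative F (at z) v) differentiable (at z)"
    using F by (auto simp: numeral_2_eq_2)
  have "dotd i (dotd j F) y = frechet_derivative (\<lambda>z. frechet_derivative F (at z) (axis j 1)) (at y) (axis i 1)"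
    for i j
    using S F' by (subst dotd_cong[OF S dotd_eq_frechet]) (auto simp: dotd_eq_frechet)
  with frechet_derivative_commute[OF S F] show ?thesis by simp
qed

lemma frechet_derivative_eq_sum_dotd:
  fixes F :: "real^'n::finite \<Rightarrow> real"
  assumes "F differentiable (at y)"
  shows "frechet_derivative F (at y) v = (\<Sum>k\<in>UNIV. v $ k * dotd k F y)"
proof -
  have lin: "linear (frechet_derivative F (at y))"
    using assms by (rule linear_frechet_derivative)
  have "frechet_derivative F (at y) v = frechet_derivative F (at y) (\<Sum>k\<in>UNIV. v $ k *\<^sub>R axis k 1)"
    by (simp add: basis_expansion flip: scalar_mult_eq_scaleR)
  then show ?thesis
    by (simp add: linear_sum[OF lin] linear_scale[OF lin] dotd_eq_frechet[OF assms])
qed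

lemma dotd_cmult:
  assumes "F differentiable (at y)"
  shows "dotd i (\<lambda>z. c * F z) y = c * dotd i F y"
proof -
  have D: "((\<lambda>z. c * F z) has_derivative (\<lambda>v. c * frechet_derivative F (at y) v)) (at y)"
    using assms by (intro has_derivative_mult_right) (simp flip: frechet_derivative_works)
  then have "dotd i (\<lambda>z. c * F z) y = frechet_derivative (\<lambda>z. c * F z) (at y) (axis i 1)"
    by (intro dotd_eq_frechet differentiableI)
  then show ?thesis
    using assms by (simp add: dotd_eq_frechet flip: frechet_derivative_at[OF D])
qed

lemma dotd_homogeneous:
  assumes "open S" and cone: "\<And>z. z \<in> S \<Longrightarrow> t *\<^sub>R z \<in> S" and t: "0 < t"
    and hom: "\<And>z. z \<in> S \<Longrightarrow> F (t *\<^sub>R z) = t * a * F z"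
    and diff: "\<And>z. z \<in> S \<Longrightarrow> F differentiable (at z)" and "y \<in> S"
  shows "dotd i F (t *\<^sub>R y) = a * dotd i F y"
proof -
  have F: "(F has_derivative frechet_derivative F (at z)) (at z)" if "z \<in> S" for z
    using diff[OF that] by (simp flip: frechet_derivative_works)
  have "((\<lambda>z. F (t *\<^sub>R z)) has_derivative (\<lambda>v. frechet_derivative F (at (t *\<^sub>R y)) (t *\<^sub>R v))) (at y)"
    by (rule has_derivative_compose[of "\<lambda>z. t *\<^sub>R z", OF _ F]) (use cone \<open>y \<in> S\<close> in \<open>auto intro!: derivative_eq_intros\<close>)
  moreover have "((\<lambda>z. F (t *\<^sub>R z)) has_derivative (\<lambda>v. t * a * frechet_derivative F (at y) v)) (at y)"
    by (rule has_derivative_transform_within_open[OF _ \<open>open S\<close> \<open>y \<in> S\<close>, of "\<lambda>z. t * a * F z"])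
      (use hom \<open>y \<in> S\<close> in \<open>auto intro!: derivative_eq_intros F\<close>)
  ultimately have "frechet_derivative F (at (t *\<^sub>R y)) (t *\<^sub>R v) = t * a * frechet_derivative F (at y) v" for v
    by (metis frechet_derivative_at)
  moreover have "linear (frechet_derivative F (at (t *\<^sub>R y)))"
    using diff cone \<open>y \<in> S\<close> by (intro linear_frechet_derivative) auto
  ultimately show ?thesis
    using t diff cone \<open>y \<in> S\<close> by (simp add: dotd_eq_frechet linear_scale mult.assoc)
qed


lemma Ck_on_const: "Ck_on k (\<lambda>x. c) S"
  by (induction k arbitrary: c) auto

locale finsler_fibre =
  fixes F :: "real^'n::finite \<Rightarrow> real"
  assumes smooth: "Ck_on 3 F (- {0})"
    and homogeneous: "\<And>t y. 0 < t \<Longrightarrow> F (t *\<^sub>R y) = t * F y"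
begin

lemma Ck_on_square: "Ck_on (Suc 2) (\<lambda>z. (F z)\<^sup>2) (- {0})"
proof -
  have "Suc 2 = 3" by simp
  with smooth show ?thesis
    unfolding power2_eq_square by (intro Ck_on_mult open_punctured) simp_all
qed

lemma Ck_on_2_square: "Ck_on 2 (\<lambda>z. (F z)\<^sup>2) (- {0})"
  using Ck_on_square by (rule Ck_on_SucD)

lemma Ck_on_dotd_square: "Ck_on 2 (dotd j (\<lambda>z. (F z)\<^sup>2)) (- {0})"
  by (rule Ck_on_dotd[OF open_punctured Ck_on_square])

lemma Ck_on_dotd_dotd_square: "Ck_on (Suc 0) (dotd i (dotd j (\<lambda>z. (F z)\<^sup>2))) (- {0})"
  by (rule Ck_on_dotd[OF open_punctured]) (use Ck_on_dotd_square in \<open>simp only: numeral_2_eq_2\<close>)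

lemma metric_component: "(\<lambda>z. metric F z $ i $ j) = (\<lambda>z. 1/2 * dotd i (dotd j (\<lambda>z. (F z)\<^sup>2)) z)"
  by (simp add: metric_def fun_eq_iff)

lemma Ck_on_metric: "Ck_on (Suc 0) (\<lambda>z. metric F z $ i $ j) (- {0})"
  unfolding metric_component by (intro Ck_on_mult Ck_on_const Ck_on_dotd_dotd_square open_punctured)

lemma metric_differentiable: "y \<noteq> 0 \<Longrightarrow> (\<lambda>z. metric F z $ i $ j) differentiable (at y)"
  using Ck_on_metric by auto

lemma metric_symmetric: "y \<noteq> 0 \<Longrightarrow> metric F y $ i $ j = metric F y $ j $ i"
  using dotd_commute[of "- {0}" y "\<lambda>z. (F z)\<^sup>2" i j, OF open_punctured _ Ck_on_2_square]
  by (simp add: metric_def)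

lemma cartan_symmetric:
  assumes "y \<noteq> 0"
  shows "cartan F y i j k = cartan F y j i k"
  unfolding cartan_def
  by (intro arg_cong[where f = "\<lambda>x. 1/2 * x"] dotd_cong[OF open_punctured])
    (use assms metric_symmetric in auto)

text \<open>Up to the factor \<open>1/4\<close>, \<open>C\<^sub>i\<^sub>j\<^sub>k\<close> is a third partial derivative of \<open>F\<^sup>2\<close>, so this is the
  symmetry of mixed derivatives applied to a first partial derivative.\<close>

lemma cartan_swap:
  assumes "y \<noteq> 0"
  shows "cartan F y i j k = cartan F y k j i"
proof -
  have c: "cartan F y i j k = 1/4 * dotd k (dotd i (dotd j (\<lambda>z. (F z)\<^sup>2))) y" for i k
  proof -
    have "dotd i (dotd j (\<lambda>z. (F z)\<^sup>2)) differentiable (at y)"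
      using Ck_on_dotd_dotd_square assms by auto
    then show ?thesis
      unfolding cartan_def metric_component by (subst dotd_cmult) auto
  qed
  show ?thesis
    unfolding c using dotd_commute[OF open_punctured _ Ck_on_dotd_square, of y k i j] assms by simp
qed

lemma metric_homogeneous:
  assumes "0 < t" "y \<noteq> 0"
  shows "metric F (t *\<^sub>R y) = metric F y"
proof -
  have d: "(\<lambda>z. (F z)\<^sup>2) differentiable (at z)" "dotd j (\<lambda>z. (F z)\<^sup>2) differentiable (at z)" if "z \<noteq> 0" for z j
    using Ck_on_2_square Ck_on_dotd_square that by (auto simp: numeral_2_eq_2)
  have "dotd j (\<lambda>z. (F z)\<^sup>2) (t *\<^sub>R z) = t * dotd j (\<lambda>z. (F z)\<^sup>2) z" if "z \<noteq> 0" for z j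
    by (rule dotd_homogeneous[OF open_punctured])
      (use assms that d in \<open>auto simp: homogeneous power2_eq_square\<close>)
  note hom = this
  have "dotd i (dotd j (\<lambda>z. (F z)\<^sup>2)) (t *\<^sub>R y) = 1 * dotd i (dotd j (\<lambda>z. (F z)\<^sup>2)) y" for i j
    by (rule dotd_homogeneous[OF open_punctured]) (use assms d hom in auto)
  then show ?thesis by (simp add: metric_def)
qed

lemma metric_has_derivative:
  assumes "y \<noteq> 0"
  shows "((\<lambda>z. metric F z $ i $ j) has_derivative (\<lambda>v. 2 * (\<Sum>k\<in>UNIV. v $ k * cartan F y i j k))) (at y)"
proof -
  have "frechet_derivative (\<lambda>z. metric F z $ i $ j) (at y) =
      (\<lambda>v. 2 * (\<Sum>k\<in>UNIV. v $ k * cartan F y i j k))"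
    using metric_differentiable[OF assms, of i j]
    by (auto simp: frechet_derivative_eq_sum_dotd cartan_def sum_distrib_left intro!: sum.cong)
  then show ?thesis
    using metric_differentiable[OF assms, of i j] by (simp add: frechet_derivative_works)
qed

text \<open>The derivative of \<open>g\<^sub>i\<^sub>j\<close> in the direction \<open>B\<close> is \<open>2 B\<^sup>k C\<^sub>i\<^sub>j\<^sub>k\<close>, and total symmetry of
  \<open>C\<close> lets \<open>B\<close> be contracted with the first index instead.\<close>

lemma metric_constant_along_annihilator:
  assumes B: "\<And>z j k. z \<noteq> 0 \<Longrightarrow> (\<Sum>i\<in>UNIV. B i * cartan F z i j k) = 0"
    and y: "\<And>t. 0 \<le> t \<Longrightarrow> y + t *\<^sub>R (\<chi> i. B i) \<noteq> 0" and t: "0 \<le> t"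
  shows "metric F (y + t *\<^sub>R (\<chi> i. B i)) = metric F y"
proof -
  let ?B = "\<chi> i. B i"
  have "((\<lambda>t. metric F (y + t *\<^sub>R ?B) $ i $ j) has_derivative (\<lambda>h. 0)) (at s within {0..t})"
    if "s \<in> {0..t}" for s i j
  proof -
    have nz: "y + s *\<^sub>R ?B \<noteq> 0" using y that by auto
    have "((\<lambda>t. metric F (y + t *\<^sub>R ?B) $ i $ j) has_derivative
       (\<lambda>h. 2 * (\<Sum>k\<in>UNIV. (h *\<^sub>R ?B) $ k * cartan F (y + s *\<^sub>R ?B) i j k))) (at s within {0..t})"
      by (rule has_derivative_compose[of "\<lambda>t. y + t *\<^sub>R ?B", OF _ metric_has_derivative[OF nz]])
        (auto intro!: derivative_eq_intros)
    moreover have "(\<Sum>k\<in>UNIV. (h *\<^sub>R ?B) $ k * cartan F (y + s *\<^sub>R ?B) i j k) = 0" for h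
      using B[OF nz, of j i]
      by (simp add: cartan_swap[OF nz, of i] mult.assoc flip: sum_distrib_left)
    ultimately show ?thesis by simp
  qed
  then have "metric F (y + t *\<^sub>R ?B) $ i $ j = metric F (y + 0 *\<^sub>R ?B) $ i $ j" for i j
    using t by (intro has_derivative_zero_unique[of "{0..t}" "\<lambda>t. metric F (y + t *\<^sub>R ?B) $ i $ j"]) auto
  then show ?thesis by (simp add: vec_eq_iff)
qed

text \<open>Here \<open>y\<close> lies off the closed ray opposite to \<open>B\<close>, so that \<open>y + tB \<noteq> 0\<close> for all
  \<open>t \<ge> 0\<close>. Invariance along \<open>B\<close> and homogeneity of degree zero give
  \<open>g(y) = g(y + tB) = g(y/t + B)\<close> for \<open>t > 0\<close>, and \<open>g\<close> is continuous at \<open>B \<noteq> 0\<close>: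
  letting \<open>t\<close> tend to infinity identifies \<open>g(y)\<close> with \<open>g(B)\<close>.\<close>

lemma metric_eq_metric_annihilator:
  assumes B: "\<And>z j k. z \<noteq> 0 \<Longrightarrow> (\<Sum>i\<in>UNIV. B i * cartan F z i j k) = 0"
    and B0: "(\<chi> i. B i) \<noteq> 0"
    and y: "norm (\<chi> i. B i) *\<^sub>R y \<noteq> - norm y *\<^sub>R (\<chi> i. B i)"
  shows "metric F y $ i $ j = metric F (\<chi> i. B i) $ i $ j"
proof -
  let ?B = "\<chi> i. B i"
  have avoid: "y + t *\<^sub>R ?B \<noteq> 0" if "0 \<le> t" for t
  proof
    assume "y + t *\<^sub>R ?B = 0"
    then have "y = - (t *\<^sub>R ?B)" by (simp add: eq_neg_iff_add_eq_0)
    with that y show False by simp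
  qed
  \<comment> \<open>The parameter \<open>t\<close> runs through the positive integers \<open>n + 1\<close>.\<close>
  have "metric F (inverse (real (Suc n)) *\<^sub>R y + ?B) = metric F y" for n
  proof -
    have "inverse (real (Suc n)) *\<^sub>R y + ?B = inverse (real (Suc n)) *\<^sub>R (y + real (Suc n) *\<^sub>R ?B)"
      by (simp add: scaleR_add_right del: of_nat_Suc)
    then show ?thesis
      using metric_homogeneous[OF _ avoid] metric_constant_along_annihilator[OF B avoid]
      by (simp del: of_nat_Suc)
  qed
  moreover have "(\<lambda>n. metric F (inverse (real (Suc n)) *\<^sub>R y + ?B) $ i $ j) \<longlonglongrightarrow> metric F ?B $ i $ j"
  proof (rule isCont_tendsto_compose[of _ "\<lambda>z. metric F z $ i $ j"])
    show "isCont (\<lambda>z. metric F z $ i $ j) ?B"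
      using metric_differentiable[OF B0] by (rule differentiable_imp_continuous_within)
    have "(\<lambda>n. inverse (real (Suc n)) *\<^sub>R y + ?B) \<longlonglongrightarrow> 0 *\<^sub>R y + ?B"
      by (intro tendsto_intros LIMSEQ_inverse_real_of_nat)
    then show "(\<lambda>n. inverse (real (Suc n)) *\<^sub>R y + ?B) \<longlonglongrightarrow> ?B" by simp
  qed
  ultimately show ?thesis
    by (simp add: LIMSEQ_const_iff)
qed

text \<open>The complement of the ray is open and \<open>g\<close> is constant on it, so the derivatives of \<open>g\<close>
  vanish there.\<close>

lemma cartan_zero_off_opposite_ray:
  assumes B: "\<And>z j k. z \<noteq> 0 \<Longrightarrow> (\<Sum>i\<in>UNIV. B i * cartan F z i j k) = 0"
    and B0: "(\<chi> i. B i) \<noteq> 0"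
    and y: "norm (\<chi> i. B i) *\<^sub>R y \<noteq> - norm y *\<^sub>R (\<chi> i. B i)"
  shows "cartan F y i j k = 0"
proof -
  let ?S = "{z. norm (\<chi> i. B i) *\<^sub>R z \<noteq> - norm z *\<^sub>R (\<chi> i. B i)}"
  have "open ?S" by (intro open_Collect_neq continuous_intros)
  then have "dotd k (\<lambda>z. metric F z $ i $ j) y = dotd k (\<lambda>z. metric F (\<chi> i. B i) $ i $ j) y"
    by (rule dotd_cong) (use y metric_eq_metric_annihilator[OF B B0] in auto)
  then show ?thesis by (simp add: cartan_def dotd_def)
qed

text \<open>A nonzero \<open>y\<close> on the ray opposite to \<open>B\<close> is not on the ray opposite to \<open>-B\<close>, and \<open>-B\<close>
  annihilates \<open>C\<close> as well.\<close>

theorem cartan_zero_if_annihilated: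
  assumes B: "\<And>z j k. z \<noteq> 0 \<Longrightarrow> (\<Sum>i\<in>UNIV. B i * cartan F z i j k) = 0"
    and B0: "(\<chi> i. B i) \<noteq> 0" and y: "y \<noteq> 0"
  shows "cartan F y i j k = 0"
proof (cases "norm (\<chi> i. B i) *\<^sub>R y = - norm y *\<^sub>R (\<chi> i. B i)")
  case False
  with B B0 show ?thesis by (rule cartan_zero_off_opposite_ray)
next
  case True
  have minus: "(\<chi> i. - B i) = - (\<chi> i. B i)" by (simp add: vec_eq_iff)
  have "norm (\<chi> i. B i) *\<^sub>R y \<noteq> norm y *\<^sub>R (\<chi> i. B i)"
  proof
    assume "norm (\<chi> i. B i) *\<^sub>R y = norm y *\<^sub>R (\<chi> i. B i)"
    with True have "norm y *\<^sub>R (\<chi> i. B i) = - (norm y *\<^sub>R (\<chi> i. B i))" by simp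
    then have "2 *\<^sub>R (norm y *\<^sub>R (\<chi> i. B i)) = 0" unfolding scaleR_2 by (metis add.right_inverse)
    with y B0 show False by simp
  qed
  then show ?thesis
    using B B0 by (intro cartan_zero_off_opposite_ray[of "\<lambda>i. - B i"]) (auto simp: minus sum_negf)
qed

end

section \<open>The raised covector\<close>

lemma differentiable_prod:
  fixes f :: "'i \<Rightarrow> 'a::real_normed_vector \<Rightarrow> real"
  assumes "finite I" "\<And>i. i \<in> I \<Longrightarrow> f i differentiable (at x)"
  shows "(\<lambda>z. \<Prod>i\<in>I. f i z) differentiable (at x)"
  using assms by (induction I) (auto intro: differentiable_mult)

lemma differentiable_det:
  fixes A :: "'a::real_normed_vector \<Rightarrow> real^'n::finite^'n"
  assumes "\<And>i j. (\<lambda>z. A z $ i $ j) differentiable (at x)"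
  shows "(\<lambda>z. det (A z)) differentiable (at x)"
  unfolding det_def
  by (intro differentiable_sum differentiable_mult differentiable_prod differentiable_const ballI assms)
     (auto simp: finite_permutations)

lemma b_up_eq: "(\<chi> i. b_up F b y i) = matrix_inv (metric F y) *v b"
  by (simp add: vec_eq_iff b_up_def metric_inv_def matrix_vector_mult_def)

lemma metric_b_up: 
  assumes "invertible (metric F y)"
  shows "metric F y *v (\<chi> i. b_up F b y i) = b"
proof -
  have "metric F y ** matrix_inv (metric F y) = mat 1"
    using assms someI_ex[of "\<lambda>A'. metric F y ** A' = mat 1 \<and> A' ** metric F y = mat 1"]
    by (auto simp: invertible_def matrix_inv_def)
  then show ?thesis by (simp add: b_up_eq matrix_vector_mul_assoc)
qed

context finsler_fibre
begin

text \<open>By Cramer's rule \<open>b\<^sup>k\<close> is a quotient of determinants in the entries of \<open>g\<close> and \<open>b\<close>.\<close>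

lemma b_up_differentiable:
  assumes inv: "\<And>z. z \<noteq> 0 \<Longrightarrow> invertible (metric F z)" and y: "y \<noteq> 0"
  shows "(\<lambda>z. b_up F b z k) differentiable (at y)"
proof -
  let ?A = "\<lambda>z. \<chi> i j. if j = k then b $ i else metric F z $ i $ j"
  have eq: "det (?A z) / det (metric F z) = b_up F b z k" if "z \<noteq> 0" for z
    using cramer[of "metric F z" "\<chi> i. b_up F b z i" b] metric_b_up[OF inv[OF that], of b]
      inv[OF that] by (simp add: invertible_det_nz vec_eq_iff)
  have "(\<lambda>z. ?A z $ i $ j) differentiable (at y)" for i j
    using metric_differentiable[OF y, of i j] by (cases "j = k") auto
  then have "(\<lambda>z. det (?A z) / det (metric F z)) differentiable (at y)"
    using inv[OF y] metric_differentiable[OF y]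
    by (intro differentiable_divide differentiable_det) (auto simp: invertible_det_nz)
  then obtain D where "((\<lambda>z. det (?A z) / det (metric F z)) has_derivative D) (at y)"
    by (auto simp: differentiable_def)
  then have "((\<lambda>z. b_up F b z k) has_derivative D) (at y)"
    by (rule has_derivative_transform_within_open[of _ _ _ _ "- {0}"]) (use y eq in auto)
  then show ?thesis by (auto simp: differentiable_def)
qed

text \<open>Differentiating \<open>g\<^sub>j\<^sub>i b\<^sup>i = b\<^sub>j\<close>, whose right-hand side does not depend on \<open>y\<close>, gives
  \<open>g\<^sub>j\<^sub>i \<partial>\<^sub>k b\<^sup>i + 2 C\<^sub>j\<^sub>i\<^sub>k b\<^sup>i = 0\<close>. The second term vanishes by the b-condition, and \<open>g\<close> is
  nondegenerate.\<close>

lemma b_up_has_derivative_zero: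
  assumes inv: "\<And>z. z \<noteq> 0 \<Longrightarrow> invertible (metric F z)" and y: "y \<noteq> 0"
    and bc: "\<And>j k. (\<Sum>i\<in>UNIV. b_up F b y i * cartan F y i j k) = 0"
  shows "((\<lambda>z. b_up F b z k) has_derivative (\<lambda>v. 0)) (at y)"
proof -
  let ?D = "\<lambda>i. frechet_derivative (\<lambda>z. b_up F b z i) (at y)"
  have D: "((\<lambda>z. b_up F b z i) has_derivative ?D i) (at y)" for i
    using b_up_differentiable[OF inv y] by (simp flip: frechet_derivative_works)
  have "?D i v = 0" for i v
  proof -
    have "(\<Sum>i\<in>UNIV. metric F y $ j $ i * ?D i v) = 0" for j
    proof -
      have "((\<lambda>z. \<Sum>i\<in>UNIV. metric F z $ j $ i * b_up F b z i) has_derivative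
          (\<lambda>v. \<Sum>i\<in>UNIV. metric F y $ j $ i * ?D i v +
             2 * (\<Sum>k\<in>UNIV. v $ k * cartan F y j i k) * b_up F b y i)) (at y)"
        by (intro has_derivative_sum has_derivative_mult D metric_has_derivative y)
      moreover have "((\<lambda>z. \<Sum>i\<in>UNIV. metric F z $ j $ i * b_up F b z i) has_derivative (\<lambda>v. 0)) (at y)"
      proof (rule has_derivative_transform_within_open[of "\<lambda>z. b $ j" _ _ _ "- {0}"])
        show "b $ j = (\<Sum>i\<in>UNIV. metric F z $ j $ i * b_up F b z i)" if "z \<in> - {0}" for z
          using metric_b_up[OF inv, of z b] that by (simp add: vec_eq_iff matrix_vector_mult_def)
      qed (use y in auto)
      ultimately have "(\<Sum>i\<in>UNIV. metric F y $ j $ i * ?D i v +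
             2 * (\<Sum>k\<in>UNIV. v $ k * cartan F y j i k) * b_up F b y i) = 0"
        by (rule has_derivative_unique[THEN fun_cong])
      moreover have "(\<Sum>i\<in>UNIV. 2 * (\<Sum>k\<in>UNIV. v $ k * cartan F y j i k) * b_up F b y i) = 0"
      proof -
        have "(\<Sum>i\<in>UNIV. 2 * (\<Sum>k\<in>UNIV. v $ k * cartan F y j i k) * b_up F b y i) =
          (\<Sum>i\<in>UNIV. \<Sum>k\<in>UNIV. 2 * v $ k * (b_up F b y i * cartan F y i j k))"
          by (simp add: cartan_symmetric[OF y, of j] sum_distrib_left sum_distrib_right mult_ac)
        also have "\<dots> = (\<Sum>k\<in>UNIV. \<Sum>i\<in>UNIV. 2 * v $ k * (b_up F b y i * cartan F y i j k))"
          by (rule sum.swap)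
        also have "\<dots> = (\<Sum>k\<in>UNIV. 2 * v $ k * (\<Sum>i\<in>UNIV. b_up F b y i * cartan F y i j k))"
          by (simp only: sum_distrib_left)
        finally show ?thesis by (simp add: bc)
      qed
      ultimately show ?thesis by (simp add: sum.distrib)
    qed
    then have "metric F y *v (\<chi> i. ?D i v) = 0"
      by (simp add: vec_eq_iff matrix_vector_mult_def)
    then have "(\<chi> i. ?D i v) = 0"
      using inv[OF y] by (meson invertible_left_inverse matrix_left_invertible_ker)
    then show ?thesis by (simp add: vec_eq_iff)
  qed
  then have "?D k = (\<lambda>v. 0)" by (simp add: fun_eq_iff)
  with D[of k] show ?thesis by simp
qed

text \<open>A fibre of dimension at least two stays connected when the origin is removed, so there
  the vanishing derivative forces a single value.\<close>

lemma b_up_constant: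
  assumes n: "2 \<le> CARD('n)"
    and inv: "\<And>z. z \<noteq> 0 \<Longrightarrow> invertible (metric F z)"
    and bc: "\<And>y j k. y \<noteq> 0 \<Longrightarrow> (\<Sum>i\<in>UNIV. b_up F b y i * cartan F y i j k) = 0"
    and yz: "y \<noteq> 0" "z \<noteq> 0"
  shows "b_up F b y = b_up F b z"
proof
  fix k
  show "b_up F b y k = b_up F b z k"
    by (rule has_derivative_zero_unique_connected[of "- {0}"])
      (use n yz b_up_has_derivative_zero[OF inv] bc in \<open>auto intro!: connected_punctured_universe\<close>)
qed

end


section \<open>Finsler manifolds with the b-condition\<close>

lemma finsler_fibre:
  assumes "finsler A L" "c \<in> A" "x \<in> chart_image c"
  shows "finsler_fibre (L c x)"
proof
  have "Ck_on 3 (\<lambda>(x, y). L c x y) (chart_image c \<times> - {0})"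
    using assms by (auto simp: finsler_def smooth_on_def)
  from Ck_on_slice[OF open_punctured assms(3) this] show "Ck_on 3 (L c x) (- {0})"
    by simp
qed (use assms in \<open>auto simp: finsler_def\<close>)

lemma finsler_metric_invertible:
  assumes "finsler A L" "c \<in> A" "x \<in> chart_image c" "y \<noteq> 0"
  shows "invertible (metric (L c x) y)"
proof -
  have "(c, x, y) \<in> slit A" using assms by (simp add: slit_def)
  with assms(1) show ?thesis by (auto simp: finsler_def dest!: bspec[of "slit A" _ "(c, x, y)"])
qed

text \<open>If \<open>b\<close> vanished at \<open>x\<close>, then so would \<open>m\<^sub>i\<close> on the whole fibre over \<open>x\<close>.\<close>

lemma one_form_nonzero:
  assumes "standing_assumption A L b" "c \<in> A" "x \<in> chart_image c"
  shows "b c x \<noteq> 0"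
  using assms by (fastforce simp: standing_assumption_def considered_def m_low_def)

text \<open>The b-condition of \<open>L\<close> makes \<open>b\<^sup>i\<close> a constant vector on each fibre, and the b-condition of
  \<open>L'\<close> says that this vector annihilates the Cartan tensor of \<open>L'\<close>. In dimension one the punctured
  fibre is disconnected, but there the contraction with \<open>b\<^sup>i\<close> is a product with one nonzero
  number.\<close>

theorem riemannian_if_b_conditions:
  fixes A :: "('m, 'n::finite) chart set"
  assumes L: "finsler A L" "standing_assumption A L b" "b_condition A L b"
    and L': "finsler A L'" "b_condition_wrt A L b L'"
  shows "riemannian A L'"
  unfolding riemannian_def
proof clarify
  fix c x y i j k
  assume "(c, x, y) \<in> slit A"
  then have c: "c \<in> A" "x \<in> chart_image c" and y: "y \<noteq> 0" by (auto simp: slit_def)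
  interpret L: finsler_fibre "L c x" using L c by (intro finsler_fibre)
  interpret L': finsler_fibre "L' c x" using L' c by (intro finsler_fibre)
  let ?B = "b_up (L c x) (b c x)"
  have inv: "\<And>z. z \<noteq> 0 \<Longrightarrow> invertible (metric (L c x) z)"
    using L c by (intro finsler_metric_invertible)
  have bL: "(\<Sum>i\<in>UNIV. ?B z i * cartan (L c x) z i j k) = 0"
    and bL': "(\<Sum>i\<in>UNIV. ?B z i * cartan (L' c x) z i j k) = 0" if "z \<noteq> 0" for z j k
  proof -
    have "(c, x, z) \<in> slit A" using c that by (simp add: slit_def)
    then show "(\<Sum>i\<in>UNIV. ?B z i * cartan (L c x) z i j k) = 0"
      "(\<Sum>i\<in>UNIV. ?B z i * cartan (L' c x) z i j k) = 0"
      using L(3) L'(2)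
      by (auto simp: b_condition_def b_condition_wrt_def dest!: bspec[of "slit A" _ "(c, x, z)"])
  qed
  have B0: "(\<chi> i. ?B y i) \<noteq> 0"
  proof
    assume "(\<chi> i. ?B y i) = 0"
    then have "b c x = 0"
      using metric_b_up[OF inv[OF y], of "b c x"] by simp
    with one_form_nonzero[OF L(2) c] show False by contradiction
  qed
  show "cartan (L' c x) y i j k = 0"
  proof (cases "2 \<le> CARD('n)")
    case True
    have "?B z = ?B y" if "z \<noteq> 0" for z
      using True inv bL that y by (rule L.b_up_constant)
    then have "(\<Sum>i\<in>UNIV. ?B y i * cartan (L' c x) z i j k) = 0" if "z \<noteq> 0" for z j k
      using bL'[OF that] that by simp
    then show ?thesis using B0 y by (rule L'.cartan_zero_if_annihilated)
  next
    case False
    then have "CARD('n) = 1"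
      using zero_less_card_finite[where 'a = 'n] by linarith
    then obtain a where a: "(UNIV :: 'n set) = {a}" by (auto simp: card_1_singleton_iff)
    then have a': "l = a" for l by auto
    obtain l where "?B y l \<noteq> 0" using B0 by (auto simp: vec_eq_iff)
    then have "?B y a \<noteq> 0" by (simp add: a'[of l])
    moreover have "?B y a * cartan (L' c x) y a j k = 0" using bL'[OF y, of j k] by (simp add: a)
    ultimately show ?thesis by (simp add: a'[of i])
  qed
qed

corollary riemannian_if_b_condition:
  assumes "finsler A L" "standing_assumption A L b" "b_condition A L b"
  shows "riemannian A L"
  using assms(1-3,1) by (rule riemannian_if_b_conditions) (use assms in \<open>simp add: b_condition_def\<close>)

lemma b_condition_if_riemannian: "riemannian A L \<Longrightarrow> b_condition A L b"
  by (force simp: riemannian_def b_condition_def b_condition_wrt_def)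

theorem theorem4p3:
  fixes M :: "'m topology"
    and A :: "('m, 'n::finite) chart set"
    and L :: "('m, 'n) chart \<Rightarrow> real^'n \<Rightarrow> real^'n \<Rightarrow> real"
    and b :: "('m, 'n) chart \<Rightarrow> real^'n \<Rightarrow> real^'n"
  assumes "smooth_manifold M A"
    and "finsler A L"
    and "one_form A b"
    and "standing_assumption A L b"
  shows
    "(CARD('n) = 2 \<and> b_condition A L b \<longrightarrow> riemannian A L) \<and>
     (CARD('n) = 3 \<and> reversible A L \<and> b_condition A L b \<longrightarrow> riemannian A L) \<and>
     (\<forall>Q. quasi_C_reducible A L Q \<and>
          (\<forall>(c, x, y) \<in> considered A L b.
             (\<Sum>i\<in>UNIV. \<Sum>j\<in>UNIV. b_up (L c x) (b c x) y i * b_up (L c x) (b c x) y j *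
                Q c x y $ i $ j) \<noteq> 0) \<and>
          b_condition A L b \<longrightarrow> riemannian A L) \<and>
     (C_reducible A L \<and> b_condition A L b \<longrightarrow> riemannian A L) \<and>
     (\<forall>L'. riemannian A L \<and> gen_beta_conformal_change A L b L' \<and> finsler A L' \<and>
          b_condition_wrt A L b L' \<longrightarrow> riemannian A L')"
  using riemannian_if_b_condition[OF assms(2,4)]
    riemannian_if_b_conditions[OF assms(2,4) b_condition_if_riemannian]
  by blast

end
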